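(* Assume that $(A,B)$ is strongly normal with respect to $\mathrm{conv}(\mathcal U)$. Furthermore, assume that $$\mathrm{ex}(\tilde{\mathcal U}_e)=\{(u,\mu)\in\mathbb R^{m+1}: u\in\mathcal U,\ \mu=\psi(u)\}.$$ Let $(u^*(t),\mu^*(t))$, where $\mu^*(t)=\psi(u^*(t))$, be the minimizer $$(u^*(t),\mu^*(t))=\arg\min_{(u,\mu)\in\tilde{\mathcal U}_e}\Big[p(t)^\top\big(A(t)x(t)+B(t)u\big)+p_c(t)\,\mu\Big],\qquad \forall t\in[0,t_f],$$ where $p_c(t)=1$ for all $t\in[0,t_f]$. Then $u^*:[0,t_f]\to\mathcal U$ is the minimizer $$u^*(t)=\arg\min_{u\in\mathcal U}\Big[\psi(u)+p(t)^\top\big(A(t)x(t)+B(t)u\big)\Big],\qquad \forall t\in[0,t_f],$$ and $u^*$ is piecewise constant on $[0,t_f]$.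
   Context: Setting. Let $t_f>0$, and consider the linear time-varying system $\dot x(t)=A(t)x(t)+B(t)u(t)$, where $A(t)\in\mathbb R^{n\times n}$, $B(t)\in\mathbb R^{n\times m}$, the pair $(A(t),B(t))$ is controllable for all $t\ge 0$, $x(t)\in\mathbb R^n$ is the state, $x(0)=x_0\in\mathbb R^n$, and $u(t)\in\mathcal U$ is the input. The input set is a finite disconnected set $\mathcal U=\{u_1,\dots,u_\ell\}\subset\mathbb R^m$, $\ell\ge 1$. The function $\psi:\mathbb R^m\to\mathbb R$ is polyhedral convex, meaning that its epigraph $\mathrm{epi}(\psi)=\{(u,\mu)\in\mathbb R^{m+1}:\psi(u)\le\mu\}$ is a polyhedral set. The underlying optimal control problem is to minimize $\int_0^{t_f}\psi(u(t))\,dt$ subject to these dynamics, $u(t)\in\mathcal U$, $x(0)=x_0$ and $x(t_f)=0$. Notation. $\mathrm{conv}$ denotes the convex hull and $\mathrm{ex}$ the set of extreme points. Put $\underline u=\min_{u\in\mathcal U}\psi(u)$, $\bar u=\max_{u\in\mathcal U}\psi(u)$, and $$\tilde{\mathcal U}_e=\big(\mathrm{conv}(\mathcal U)\times[\underline u,\bar u]\big)\cap\mathrm{epi}(\psi)\subset\mathbb R^{m+1}.$$ Costates. $p(t)\in\mathbb R^n$ is the costate associated with $x$: $\dot p(t)=-A(t)^\top p(t)$, $p(0)=p_0\in\mathbb R^n\setminus\{0\}$. $p_c$ is the costate associated with the scalar cost state $x_c$, where $\dot x_c(t)=\mu(t)$, $x_c(0)=0$, and $x_c(t_f)$ is the terminal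 cost of the reformulated problem; hence $p_c\equiv 1$. Strong normality. A linear system $(F,G)$, $\dot z(t)=F(t)z(t)+G(t)w(t)$ with $z(t)\in\mathbb R^N$, is strongly normal with respect to a polytope $W$ of inputs if, for every $q_0\in\mathbb R^N\setminus\{0\}$ and for all but a finite set of points $t\in[0,t_f]$, the problem $\arg\min_{w\in W}\,q(t)^\top\big(F(t)z(t)+G(t)w\big)$ has a unique solution, where $q$ is the costate, $\dot q(t)=-F(t)^\top q(t)$, $q(0)=q_0$. (The term $q^\top Fz$ does not depend on $w$.) The hypothesis of the theorem is this with $(F,G)=(A,B)$, $N=n$, $W=\mathrm{conv}(\mathcal U)$.
   Formalization: A(t), B(t) are assumed piecewise continuous, and the minimizer over the extended set is assumed unique off a finite set of times (it does not follow from strong normality); at those exceptional times u* is only shown optimal against U, not in U. *)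

theory Defs
  imports "HOL-Analysis.Analysis"
begin

definition argmin_on :: "('a \<Rightarrow> real) \<Rightarrow> 'a set \<Rightarrow> 'a set" where
  "argmin_on f W = {w. is_arg_min f (\<lambda>v. v \<in> W) w}"

(* Finitely many breakpoints, with finite one-sided limits at every point; at an endpoint of the
   interval the outer one-sided limit is along the trivial filter, so it imposes nothing. *)
definition piecewise_continuous_on :: "real \<Rightarrow> real \<Rightarrow> (real \<Rightarrow> 'a::topological_space) \<Rightarrow> bool" where
  "piecewise_continuous_on a b f \<longleftrightarrow>
     (\<exists>S. finite S \<and> continuous_on ({a..b} - S) f) \<and>
     (\<forall>s\<in>{a..b}. (\<exists>l. (f \<longlongrightarrow> l) (at s within {a..<s})) \<and> (\<exists>l. (f \<longlongrightarrow> l) (at s within {s<..b})))"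

(* Constant between consecutive points of a finite set; the values at those points are free. *)
definition piecewise_constant_on :: "real \<Rightarrow> real \<Rightarrow> (real \<Rightarrow> 'a) \<Rightarrow> bool" where
  "piecewise_constant_on a b f \<longleftrightarrow>
     (\<exists>S. finite S \<and> (\<forall>c d. {c<..<d} \<subseteq> {a..b} - S \<longrightarrow> (\<exists>y. \<forall>t\<in>{c<..<d}. f t = y)))"

(* Solution of z' = f(t, z) in the sense of Caratheodory: z' = f(t, z) holds almost everywhere
   and z is the integral of its derivative. *)
definition ode_solution_on ::
  "real \<Rightarrow> real \<Rightarrow> (real \<Rightarrow> 'a \<Rightarrow> 'a::euclidean_space) \<Rightarrow> (real \<Rightarrow> 'a) \<Rightarrow> bool" where
  "ode_solution_on a b f z \<longleftrightarrow>
     (\<lambda>s. f s (z s)) absolutely_integrable_on {a..b} \<and>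
     (\<forall>t\<in>{a..b}. z t = z a + integral {a..t} (\<lambda>s. f s (z s)))"

definition state_trajectory ::
  "real \<Rightarrow> real \<Rightarrow> (real \<Rightarrow> real^'n^'n) \<Rightarrow> (real \<Rightarrow> real^'m^'n) \<Rightarrow>
   (real \<Rightarrow> real^'m) \<Rightarrow> (real \<Rightarrow> real^'n) \<Rightarrow> bool" where
  "state_trajectory a b F G w z \<longleftrightarrow>
     w absolutely_integrable_on {a..b} \<and> ode_solution_on a b (\<lambda>t y. F t *v y + G t *v w t) z"

definition costate :: "real \<Rightarrow> (real \<Rightarrow> real^'n^'n) \<Rightarrow> real^'n \<Rightarrow> (real \<Rightarrow> real^'n) \<Rightarrow> bool" where
  "costate tf F q0 q \<longleftrightarrow>
     q 0 = q0 \<and> ode_solution_on 0 tf (\<lambda>t y. - (transpose (F t) *v y)) q"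

(* Controllability at initial time t0 of the time-varying pair (F, G): any state at t0 can be
   transferred to any other state in a common finite time. *)
definition controllable_at ::
  "(real \<Rightarrow> real^'n^'n) \<Rightarrow> (real \<Rightarrow> real^'m^'n) \<Rightarrow> real \<Rightarrow> bool" where
  "controllable_at F G t0 \<longleftrightarrow>
     (\<exists>t1>t0. \<forall>z0 z1. \<exists>w z. state_trajectory t0 t1 F G w z \<and> z t0 = z0 \<and> z t1 = z1)"

(* The term in z shifts the objective by a constant, so the choice of z is immaterial. *)
definition strongly_normal ::
  "real \<Rightarrow> (real \<Rightarrow> real^'n^'n) \<Rightarrow> (real \<Rightarrow> real^'m^'n) \<Rightarrow> (real^'m) set \<Rightarrow> bool" where
  "strongly_normal tf F G W \<longleftrightarrow>
     (\<forall>q0 q z. q0 \<noteq> 0 \<longrightarrow> costate tf F q0 q \<longrightarrow>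
        finite {t\<in>{0..tf}. \<not> (\<exists>!w. w \<in> argmin_on (\<lambda>w. q t \<bullet> (F t *v z t + G t *v w)) W)})"

definition extended_input_set :: "(real^'m \<Rightarrow> real) \<Rightarrow> (real^'m) set \<Rightarrow> ((real^'m) \<times> real) set" where
  "extended_input_set \<psi> U =
     ((convex hull U) \<times> {Min (\<psi> ` U)..Max (\<psi> ` U)}) \<inter> epigraph UNIV \<psi>"

end

theory Submission
  imports Defs
begin

text \<open>
  A unique minimizer of an affine functional is an extreme point, so wherever the minimizer over
  the extended input set is unique it is some (v, \<psi> v) with v in U. Away from the finitely many
  exceptional times and discontinuities of B, this v is thus the strict minimizer among finitely
  many functions that are continuous in time, and so is locally constant in time.
\<close>

lemma mem_argmin_on: "w \<in> argmin_on f W \<longleftrightarrow> w \<in> W \<and> (\<forall>v\<in>W. f w \<le> f v)"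
  by (auto simp: argmin_on_def is_arg_min_def not_less)

text \<open>A point strictly between \<open>a\<close> and \<open>b\<close> has as its value a proper
  convex combination of \<open>f a\<close> and \<open>f b\<close>. Uniqueness makes both strictly
  larger than \<open>f e\<close>, which is absurd for \<open>e\<close>. The constant
  \<open>c\<close> leaves room for the state term of the objective.\<close>

lemma unique_affine_minimizer_extreme_point:
  fixes f :: "'a::real_vector \<Rightarrow> real"
  assumes f: "linear f" and min: "argmin_on (\<lambda>w. c + f w) W = {e}"
  shows "e extreme_point_of W"
  unfolding extreme_point_of_def
proof (intro conjI ballI notI)
  have e: "e \<in> W" "\<And>w. w \<in> W \<Longrightarrow> f e \<le> f w"
    using min by (auto simp: set_eq_iff mem_argmin_on)
  have strict: "f e < f w" if "w \<in> W" "w \<noteq> e" for w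
  proof (rule ccontr)
    assume "\<not> f e < f w"
    then have "w \<in> argmin_on (\<lambda>w. c + f w) W"
      using e that by (fastforce simp: mem_argmin_on)
    then show False using min that by simp
  qed
  show "e \<in> W" by fact
  fix a b assume ab: "a \<in> W" "b \<in> W" and seg: "e \<in> open_segment a b"
  then obtain s where s: "0 < s" "s < 1" "e = (1 - s) *\<^sub>R a + s *\<^sub>R b"
    by (auto simp: in_segment)
  have "a \<noteq> e" "b \<noteq> e" using seg by (auto simp: open_segment_def)
  then have "(1 - s) * f e + s * f e < (1 - s) * f a + s * f b"
    using strict ab s by (intro add_strict_mono mult_strict_left_mono) auto
  also have "\<dots> = f e"
    by (simp add: s(3) linear_add[OF f] linear_scale[OF f])
  finally show False by (simp add: algebra_simps)
qed

text \<open>At each time the minimizer beats finitely many rivals strictly. By continuity it still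
  does so at nearby times, so \<open>m\<close> is locally constant, hence constant on a connected
  set.\<close>

lemma strict_minimizer_constant_on_connected:
  fixes f :: "'a \<Rightarrow> 'b::topological_space \<Rightarrow> real"
  assumes "finite U" and T: "connected T"
    and cont: "\<And>v. v \<in> U \<Longrightarrow> continuous_on T (f v)"
    and min: "\<And>t. t \<in> T \<Longrightarrow> argmin_on (\<lambda>v. f v t) U = {m t}"
  shows "\<exists>y. \<forall>t\<in>T. m t = y"
proof -
  have m: "m t \<in> U" "\<And>v. v \<in> U \<Longrightarrow> f (m t) t \<le> f v t" if "t \<in> T" for t
    using min[OF that] by (auto simp: set_eq_iff mem_argmin_on)
  have strict: "f (m t) t < f v t" if "t \<in> T" "v \<in> U - {m t}" for t v
  proof (rule ccontr)
    assume "\<not> f (m t) t < f v t"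
    then have "v \<in> argmin_on (\<lambda>v. f v t) U"
      using m that by (fastforce simp: mem_argmin_on)
    then show False using min that by simp
  qed
  have "\<forall>t\<in>T. eventually (\<lambda>s. m t = m s) (at t within T)"
  proof
    fix t assume t: "t \<in> T"
    have "\<forall>\<^sub>F s in at t within T. f (m t) s < f v s" if "v \<in> U - {m t}" for v
    proof -
      \<comment> \<open>The competitor \<open>m t\<close> is frozen at time \<open>t\<close> while
        \<open>s\<close> varies, so only continuity of each \<open>f v\<close> is used and none of
        \<open>m\<close>.\<close>
      have "((\<lambda>s. f v s - f (m t) s) \<longlongrightarrow> f v t - f (m t) t) (at t within T)"
        using cont m t that by (intro tendsto_diff) (auto simp: continuous_on_def)
      then have "\<forall>\<^sub>F s in at t within T. 0 < f v s - f (m t) s"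
        using strict[OF t that] by (intro order_tendstoD(1)) auto
      then show ?thesis by eventually_elim simp
    qed
    then have "\<forall>\<^sub>F s in at t within T. \<forall>v\<in>U - {m t}. f (m t) s < f v s"
      using \<open>finite U\<close> by (simp add: eventually_ball_finite)
    moreover have "\<forall>\<^sub>F s in at t within T. s \<in> T"
      by (simp add: eventually_at_filter)
    ultimately show "\<forall>\<^sub>F s in at t within T. m t = m s"
    proof eventually_elim
      case (elim s)
      then show ?case using m t by (metis DiffI not_less singletonD)
    qed
  qed
  then show ?thesis using connected_local_const[OF T] by metis
qed

text \<open>The Caratheodory notion contains the integral equation, and an indefinite integral is
  continuous even if \<open>f\<close> jumps in time. This supplies continuity of the
  costate.\<close>

lemma ode_solution_on_imp_continuous_on:
  assumes "ode_solution_on a b f z"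
  shows "continuous_on {a..b} z"
proof -
  have "(\<lambda>s. f s (z s)) integrable_on {a..b}"
    using assms by (auto simp: ode_solution_on_def absolutely_integrable_on_def)
  then have "continuous_on {a..b} (\<lambda>t. z a + integral {a..t} (\<lambda>s. f s (z s)))"
    by (intro continuous_intros indefinite_integral_continuous_1)
  then show ?thesis
    by (rule continuous_on_eq) (metis assms ode_solution_on_def)
qed

lemma continuous_on_matrix_vector_mult:
  fixes F :: "'a::topological_space \<Rightarrow> real^'m^'n"
  assumes "continuous_on T F"
  shows "continuous_on T (\<lambda>t. F t *v v)"
  unfolding matrix_vector_mult_def
  using assms by (intro continuous_intros) auto

theorem theorem1:
  fixes tf :: real
    and A :: "real \<Rightarrow> real^'n^'n"
    and B :: "real \<Rightarrow> real^'m^'n"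
    and U :: "(real^'m) set"
    and \<psi> :: "real^'m \<Rightarrow> real"
    and x0 p0 :: "real^'n"
    and x p :: "real \<Rightarrow> real^'n"
    and u u_star :: "real \<Rightarrow> real^'m"
    and p_c \<mu>_star :: "real \<Rightarrow> real"
    and E :: "real set"
  assumes "tf > 0"
    and "\<And>T. T > 0 \<Longrightarrow> piecewise_continuous_on 0 T A"
    and "\<And>T. T > 0 \<Longrightarrow> piecewise_continuous_on 0 T B"
    and "\<And>t. t \<ge> 0 \<Longrightarrow> controllable_at A B t"
    and "finite U" and "U \<noteq> {}"
    and "polyhedron (epigraph UNIV \<psi>)"
    and "state_trajectory 0 tf A B u x" and "x 0 = x0"
    and "p0 \<noteq> 0" and "costate tf A p0 p"
    and "\<And>t. t \<in> {0..tf} \<Longrightarrow> p_c t = 1"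
    and "strongly_normal tf A B (convex hull U)"
    and "{w. w extreme_point_of (extended_input_set \<psi> U)} = {(v, \<mu>). v \<in> U \<and> \<mu> = \<psi> v}"
    and "\<And>t. t \<in> {0..tf} \<Longrightarrow> \<mu>_star t = \<psi> (u_star t)"
    and "\<And>t. t \<in> {0..tf} \<Longrightarrow>
           (u_star t, \<mu>_star t) \<in>
             argmin_on (\<lambda>(v, \<mu>). p t \<bullet> (A t *v x t + B t *v v) + p_c t * \<mu>) (extended_input_set \<psi> U)"
    and "finite E"
    and "\<And>t. t \<in> {0..tf} - E \<Longrightarrow>
           argmin_on (\<lambda>(v, \<mu>). p t \<bullet> (A t *v x t + B t *v v) + p_c t * \<mu>) (extended_input_set \<psi> U)
             = {(u_star t, \<mu>_star t)}"
  shows "(\<forall>t\<in>{0..tf} - E.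
            u_star t \<in> U \<and>
            argmin_on (\<lambda>v. \<psi> v + p t \<bullet> (A t *v x t + B t *v v)) U = {u_star t}) \<and>
         (\<forall>t\<in>{0..tf}. \<forall>v\<in>U.
            \<psi> (u_star t) + p t \<bullet> (A t *v x t + B t *v u_star t)
              \<le> \<psi> v + p t \<bullet> (A t *v x t + B t *v v)) \<and>
         piecewise_constant_on 0 tf u_star"
proof -
  let ?X = "extended_input_set \<psi> U"
  let ?H = "\<lambda>t (v, \<mu>). p t \<bullet> (A t *v x t + B t *v v) + p_c t * \<mu>"
  let ?h = "\<lambda>t v. \<psi> v + p t \<bullet> (A t *v x t + B t *v v)"
  note ext = assms(14) and mu = assms(15) and min = assms(16) and uniq = assms(18)
  \<comment> \<open>Extreme points belong to their set, so the hypothesis on extreme points already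
    gives membership.\<close>
  have emb: "(v, \<psi> v) \<in> ?X" if "v \<in> U" for v
    using ext that by (auto simp: extreme_point_of_def set_eq_iff)
  \<comment> \<open>Comparing with the lifted points \<open>(v, \<psi> v)\<close> needs no
    uniqueness, so this also covers times in \<open>E\<close>, where \<open>u_star t\<close> is not
    claimed to lie in \<open>U\<close>.\<close>
  have le: "?h t (u_star t) \<le> ?h t v" if "t \<in> {0..tf}" "v \<in> U" for t v
  proof -
    have "?H t (u_star t, \<mu>_star t) \<le> ?H t (v, \<psi> v)"
      using min[OF that(1)] emb[OF that(2)] unfolding mem_argmin_on by blast
    then show ?thesis using assms(12) mu that by simp
  qed
  have in_U: "u_star t \<in> U" if t: "t \<in> {0..tf} - E" for t
  proof -
    \<comment> \<open>The part of \<open>?H t\<close> that is linear in the pair; the state term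
      becomes the constant \<open>c\<close> of the lemma.\<close>
    let ?f = "\<lambda>(v, \<mu>). p t \<bullet> (B t *v v) + p_c t * \<mu>"
    have "linear ?f"
      by (rule linearI) (auto simp: algebra_simps)
    moreover have "argmin_on (\<lambda>w. p t \<bullet> (A t *v x t) + ?f w) ?X = {(u_star t, \<mu>_star t)}"
      using uniq[OF t] by (simp add: inner_add_right case_prod_unfold add.assoc)
    ultimately have "(u_star t, \<mu>_star t) extreme_point_of ?X"
      by (rule unique_affine_minimizer_extreme_point)
    then show ?thesis using ext by auto
  qed
  \<comment> \<open>A minimizer \<open>v\<close> over \<open>U\<close> does at least as well as
    \<open>u_star t\<close>, so its lift \<open>(v, \<psi> v)\<close> minimizes over all of
    \<open>?X\<close>, and uniqueness there forces \<open>v = u_star t\<close>.\<close>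
  have argmin: "argmin_on (?h t) U = {u_star t}" if t: "t \<in> {0..tf} - E" for t
  proof (intro equalityI subsetI)
    fix v assume v: "v \<in> argmin_on (?h t) U"
    then have "v \<in> U" "?h t v \<le> ?h t (u_star t)"
      using in_U[OF t] by (auto simp: mem_argmin_on)
    then have "?H t (v, \<psi> v) \<le> ?H t (u_star t, \<mu>_star t)"
      using assms(12)[of t] mu[of t] t by simp
    moreover have "\<forall>w\<in>?X. ?H t (u_star t, \<mu>_star t) \<le> ?H t w"
      using min t unfolding mem_argmin_on by blast
    ultimately have "(v, \<psi> v) \<in> argmin_on (?H t) ?X"
      using emb[OF \<open>v \<in> U\<close>] unfolding mem_argmin_on by (meson order_trans)
    then show "v \<in> {u_star t}" using uniq[OF t] by simp
  next
    fix v assume "v \<in> {u_star t}"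
    then show "v \<in> argmin_on (?h t) U" using in_U[OF t] le t by (simp add: mem_argmin_on)
  qed
  obtain S where S: "finite S" "continuous_on ({0..tf} - S) B"
    using assms(3)[OF \<open>tf > 0\<close>] by (auto simp: piecewise_continuous_on_def)
  have p: "continuous_on {0..tf} p"
    using assms(11) unfolding costate_def by (blast intro: ode_solution_on_imp_continuous_on)
  have "piecewise_constant_on 0 tf u_star"
    unfolding piecewise_constant_on_def
  \<comment> \<open>Between these breakpoints \<open>B\<close> is continuous (off \<open>S\<close>)
    and the minimizer over \<open>U\<close> is unique (off \<open>E\<close>).\<close>
  proof (intro exI[of _ "S \<union> E"] conjI allI impI)
    show "finite (S \<union> E)" using S \<open>finite E\<close> by simp
    fix c d assume cd: "{c<..<d} \<subseteq> {0..tf} - (S \<union> E)"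
    show "\<exists>y. \<forall>t\<in>{c<..<d}. u_star t = y"
    proof (rule strict_minimizer_constant_on_connected[OF \<open>finite U\<close>])
      \<comment> \<open>The state term does not depend on v; dropping it avoids any continuity of A.\<close>
      let ?g = "\<lambda>v t. \<psi> v + p t \<bullet> (B t *v v)"
      show "continuous_on {c<..<d} (?g v)" for v
        using cd by (intro continuous_intros continuous_on_matrix_vector_mult
            continuous_on_subset[OF p] continuous_on_subset[OF S(2)]) auto
      show "argmin_on (\<lambda>v. ?g v t) U = {u_star t}" if "t \<in> {c<..<d}" for t
      proof -
        have "argmin_on (\<lambda>v. ?g v t) U = argmin_on (?h t) U"
          by (auto simp: mem_argmin_on inner_add_right)
        then show ?thesis using argmin[of t] cd that by auto
      qed
    qed simp
  qed
  then show ?thesis using in_U argmin le by blast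
qed

end
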